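(* Let $X,Y$ be Banach spaces, let $A:D(A)\subset X\to X$ generate a $C_0$-semigroup $T(\cdot)$ on $X$, and let $C\in\mathcal L(X,Y)$. For the system $\dot x(t)=Ax(t)$, $y(t)=Cx(t)$, the following are equivalent: (i) The system admits a coercive eOSS Lyapunov function in implication form. (ii) The system is eOSS. (iii) The system is UGESMO.
   Context: $\mathcal L(X,Y)$ denotes the bounded linear operators from $X$ to $Y$. $\mathbb R_+=[0,\infty)$. $\mathcal K$ is the set of continuous strictly increasing $\gamma:\mathbb R_+\to\mathbb R_+$ with $\gamma(0)=0$, and $\mathcal K_\infty$ the set of unbounded $\gamma\in\mathcal K$. The mild solution with initial state $x\in X$ is $\phi(t,x)=T(t)x$ and the output trajectory is $y(t,x)=CT(t)x$, $t\ge0$. Lie derivative: $\dot V(x):=\limsup_{\tau\to+0}\frac{V(\phi(\tau,x))-V(x)}{\tau}$ (limsup in the extended real line), provided $t\mapsto V(\phi(t,x))$ is continuous at $t=0$. $V:X\to\mathbb R_+$ is a coercive eOSS Lyapunov function in implication form if: (a) there exist $k_1,k_2,p>0$ with $k_1\|x\|_X^p\le V(x)\le k_2\|x\|_X^p$ for all $x\in X$; (b) for every $x\in X$ the map $t\mapsto V(\phi(t,x))$, $t\ge0$, is continuous; (c') there exist $\tilde\alpha>0$ and $\chi\in\mathcal K_\infty$ such that, with $p$ as in (a), for every $x\in X$: $\|x\|_X\ge\chi(\|Cx\|_Y)\Rightarrow\dot V(x)\le-\tilde\alpha\|x\|_X^p$. The system is eOSS (exponentially output-to-state stable) if there exist $M,\mu>0$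 and $\gamma\in\mathcal K$ such that for all $x\in X$ and $t\ge0$: $\|\phi(t,x)\|_X\le Me^{-\mu t}\|x\|_X+\gamma\bigl(\max_{s\in[0,t]}\|y(s,x)\|_Y\bigr)$. The system is UGESMO (uniformly globally exponentially stable modulo output) if there exist $\rho>0$ and $M,\mu>0$ such that for all $x\in X$ and all $\tau\ge0$: if $\|\phi(t,x)\|_X\ge\rho\|y(t,x)\|_Y$ for all $t\in[0,\tau]$, then $\|\phi(t,x)\|_X\le Me^{-\mu t}\|x\|_X$ for all $t\in[0,\tau]$. *)

theory Defs
  imports "HOL-Analysis.Analysis"
begin

text \<open>
  Banach spaces are real (class \<^class>\<open>banach\<close>). Complex Banach spaces are covered by
  restriction of scalars: none of the notions below depends on the scalar field.
\<close>

definition C0_semigroup :: "(real \<Rightarrow> ('a::banach \<Rightarrow>\<^sub>L 'a)) \<Rightarrow> bool" where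
  "C0_semigroup T \<longleftrightarrow>
     T 0 = id_blinfun \<and>
     (\<forall>s\<ge>0. \<forall>t\<ge>0. T (s + t) = T s o\<^sub>L T t) \<and>
     (\<forall>x. ((\<lambda>t. blinfun_apply (T t) x) \<longlongrightarrow> x) (at_right 0))"

text \<open>
  The unbounded operator \<open>A : D(A) \<subset> X \<rightarrow> X\<close> is a function \<open>A\<close> together with its domain \<open>D\<close>;
  the values of \<open>A\<close> outside \<open>D\<close> are irrelevant.
\<close>

definition generates_C0_semigroup ::
  "('a::banach \<Rightarrow> 'a) \<Rightarrow> 'a set \<Rightarrow> (real \<Rightarrow> ('a \<Rightarrow>\<^sub>L 'a)) \<Rightarrow> bool" where
  "generates_C0_semigroup A D T \<longleftrightarrow>
     C0_semigroup T \<and>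
     D = {x. \<exists>z. ((\<lambda>t. (blinfun_apply (T t) x - x) /\<^sub>R t) \<longlongrightarrow> z) (at_right 0)} \<and>
     (\<forall>x\<in>D. ((\<lambda>t. (blinfun_apply (T t) x - x) /\<^sub>R t) \<longlongrightarrow> A x) (at_right 0))"

text \<open>
  Comparison functions \<open>\<real>\<^sub>+ \<rightarrow> \<real>\<^sub>+\<close> are functions on \<^typ>\<open>real\<close> of which only the restriction
  to \<open>[0, \<infinity>)\<close> matters.
\<close>

definition class_K :: "(real \<Rightarrow> real) set" where
  "class_K = {\<gamma>. \<gamma> \<in> {0..} \<rightarrow> {0..} \<and> continuous_on {0..} \<gamma> \<and>
                  strict_mono_on {0..} \<gamma> \<and> \<gamma> 0 = 0}"

definition class_K_inf :: "(real \<Rightarrow> real) set" where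
  "class_K_inf = {\<gamma> \<in> class_K. \<not> bounded (\<gamma> ` {0..})}"

definition mild_solution :: "(real \<Rightarrow> ('a::banach \<Rightarrow>\<^sub>L 'a)) \<Rightarrow> real \<Rightarrow> 'a \<Rightarrow> 'a" where
  "mild_solution T t x = blinfun_apply (T t) x"

definition output_trajectory ::
  "(real \<Rightarrow> ('a::banach \<Rightarrow>\<^sub>L 'a)) \<Rightarrow> ('a \<Rightarrow>\<^sub>L 'b::banach) \<Rightarrow> real \<Rightarrow> 'a \<Rightarrow> 'b" where
  "output_trajectory T C t x = blinfun_apply C (mild_solution T t x)"

definition lie_derivative ::
  "(real \<Rightarrow> ('a::banach \<Rightarrow>\<^sub>L 'a)) \<Rightarrow> ('a \<Rightarrow> real) \<Rightarrow> 'a \<Rightarrow> ereal" where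
  "lie_derivative T V x =
     Limsup (at_right 0) (\<lambda>\<tau>. ereal ((V (mild_solution T \<tau> x) - V x) / \<tau>))"

definition coercive_eOSS_Lyapunov_impl ::
  "(real \<Rightarrow> ('a::banach \<Rightarrow>\<^sub>L 'a)) \<Rightarrow> ('a \<Rightarrow>\<^sub>L 'b::banach) \<Rightarrow> ('a \<Rightarrow> real) \<Rightarrow> bool" where
  "coercive_eOSS_Lyapunov_impl T C V \<longleftrightarrow>
     (\<forall>x. V x \<ge> 0) \<and>
     (\<exists>k1>0. \<exists>k2>0. \<exists>p>0.
        (\<forall>x. k1 * norm x powr p \<le> V x \<and> V x \<le> k2 * norm x powr p) \<and>
        (\<forall>x. continuous_on {0..} (\<lambda>t. V (mild_solution T t x))) \<and>
        (\<exists>\<alpha>>0. \<exists>\<eta>\<in>class_K_inf. \<forall>x.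
           norm x \<ge> \<eta> (norm (blinfun_apply C x)) \<longrightarrow>
             lie_derivative T V x \<le> ereal (- \<alpha> * norm x powr p)))"

text \<open>
  The maximum of \<open>\<parallel>y(s,x)\<parallel>\<close> over \<open>s \<in> [0,t]\<close> is written as a supremum. It is attained,
  because the orbits of a \<open>C\<^sub>0\<close>-semigroup are continuous on \<open>[0,t]\<close>.
\<close>

definition eOSS ::
  "(real \<Rightarrow> ('a::banach \<Rightarrow>\<^sub>L 'a)) \<Rightarrow> ('a \<Rightarrow>\<^sub>L 'b::banach) \<Rightarrow> bool" where
  "eOSS T C \<longleftrightarrow>
     (\<exists>M>0. \<exists>\<mu>>0. \<exists>\<gamma>\<in>class_K. \<forall>x. \<forall>t\<ge>0.
        norm (mild_solution T t x) \<le>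
          M * exp (- \<mu> * t) * norm x + \<gamma> (SUP s\<in>{0..t}. norm (output_trajectory T C s x)))"

definition UGESMO ::
  "(real \<Rightarrow> ('a::banach \<Rightarrow>\<^sub>L 'a)) \<Rightarrow> ('a \<Rightarrow>\<^sub>L 'b::banach) \<Rightarrow> bool" where
  "UGESMO T C \<longleftrightarrow>
     (\<exists>\<rho>>0. \<exists>M>0. \<exists>\<mu>>0. \<forall>x. \<forall>\<tau>\<ge>0.
        (\<forall>t\<in>{0..\<tau>}. norm (mild_solution T t x) \<ge> \<rho> * norm (output_trajectory T C t x)) \<longrightarrow>
        (\<forall>t\<in>{0..\<tau>}. norm (mild_solution T t x) \<le> M * exp (- \<mu> * t) * norm x))"

end

theory Submission
  imports Defs
begin

text \<open>
  The three properties are shown to imply each other in a cycle.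

  A Lyapunov function \<open>V\<close> decays exponentially as long as the state is large compared with the
  output. Along a trajectory, \<open>V\<close> therefore lies below the maximum of an exponentially decaying term
  and the largest value that the output allows (\<open>decay_above_level_bound\<close>); by coercivity, this is
  output-to-state stability (\<open>Lyapunov_impl_imp_eOSS\<close>).

  The system is linear, so the gain in the output-to-state estimate can be taken linear
  (\<open>eOSS_linear_gain\<close>). As long as the state dominates a large multiple of the output, the output
  term is then a small multiple of the largest norm of the state and can be absorbed; over a fixed
  time the state shrinks to half its norm, and iteration gives stability modulo output
  (\<open>eOSS_imp_UGESMO\<close>).

  The main step is the construction of \<open>V\<close> from stability modulo output
  (\<open>UGESMO_imp_Lyapunov_impl\<close>). The usual candidate \<open>sup t. exp (\<mu> t) \<parallel>T t x\<parallel>\<close> decays at the rate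
  \<open>\<mu>\<close>, but it may be infinite, as the estimate \<open>\<parallel>T t x\<parallel> \<le> M exp (- \<mu> t) \<parallel>x\<parallel>\<close> holds only until the
  trajectory leaves the region \<open>\<parallel>x\<parallel> \<ge> \<rho> \<parallel>Cx\<parallel>\<close>. Stopping the supremum at the exit time makes it,
  in general, discontinuous along trajectories. Instead the values after time \<open>s\<close> are capped
  continuously, by a weighted multiple of the margin \<open>\<parallel>x\<parallel> - \<rho> \<parallel>Cx\<parallel>\<close> at time \<open>s\<close>:
  \<open>W x = sup t. min (f t) (inf s \<le> t. u s)\<close> with \<open>f t = exp (\<mu> t) \<parallel>T t x\<parallel>\<close> and
  \<open>u s = K exp (\<mu> s) (\<parallel>T s x\<parallel> - \<rho> \<parallel>CT s x\<parallel>)\<close>. The term \<open>s = 0\<close> alone gives \<open>W x \<le> K \<parallel>x\<parallel>\<close>, and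
  \<open>W\<close> is continuous along trajectories because a supremum of this kind depends continuously on its
  initial time (\<open>continuous_on_gated_sup\<close>). Well inside the region, the cap at small \<open>s\<close> has no
  effect when \<open>K\<close> is large: \<open>u s \<ge> M exp (\<mu> s) \<parallel>T s x\<parallel>\<close> there, and stability modulo output says
  that \<open>f t\<close> does not exceed this number for any \<open>t\<close> up to the exit time. Discarding the initial
  piece of the trajectory thus cannot increase the supremum, and \<open>W\<close> decays at the rate \<open>\<mu>\<close>.
  Outside the region \<open>W\<close> may be small or negative; \<open>V x = max \<parallel>x\<parallel> (W x)\<close> is coercive and agrees with
  \<open>W\<close> well inside it.
\<close>

section \<open>Continuity of semigroup orbits\<close>

lemma C0_semigroup_zero: "C0_semigroup T \<Longrightarrow> blinfun_apply (T 0) x = x"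
  by (simp add: C0_semigroup_def)

lemma C0_semigroup_add:
  assumes "C0_semigroup T" "0 \<le> s" "0 \<le> t"
  shows "blinfun_apply (T (s + t)) x = blinfun_apply (T s) (blinfun_apply (T t) x)"
  using assms by (simp add: C0_semigroup_def)

text \<open>
  Baire's theorem: the closed sets of states whose orbit stays below \<open>n\<close> up to time \<open>1 / (n + 1)\<close>
  exhaust the space, so one of them contains a ball, and linearity spreads the bound from that
  ball to the whole space.
\<close>

lemma C0_semigroup_bounded_near_0:
  fixes T :: "real \<Rightarrow> ('a::banach \<Rightarrow>\<^sub>L 'a)"
  assumes T: "C0_semigroup T"
  obtains d B where "d > 0" "B \<ge> 0"
    "\<And>t x. 0 \<le> t \<Longrightarrow> t \<le> d \<Longrightarrow> norm (blinfun_apply (T t) x) \<le> B * norm x"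
proof -
  define E where "E n = (\<Inter>t\<in>{0..1 / real (Suc n)}. {x. norm (blinfun_apply (T t) x) \<le> real n})" for n
  have closed_E: "closed (E n)" for n
    unfolding E_def by (intro closed_INT ballI closed_Collect_le continuous_intros)
  have "\<exists>n. x \<in> E n" for x
  proof -
    have "((\<lambda>t. norm (blinfun_apply (T t) x)) \<longlongrightarrow> norm x) (at_right 0)"
      using T by (intro tendsto_norm) (simp add: C0_semigroup_def)
    then have "eventually (\<lambda>t. norm (blinfun_apply (T t) x) < norm x + 1) (at_right 0)"
      by (rule order_tendstoD) simp
    then obtain d where d: "d > 0" "\<And>t. 0 < t \<Longrightarrow> t < d \<Longrightarrow> norm (blinfun_apply (T t) x) < norm x + 1"
      unfolding eventually_at_right_field by auto
    obtain n1 where n1: "1 / real (Suc n1) < d"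
      using nat_approx_posE[OF d(1)] by blast
    obtain n2 where n2: "norm x + 1 \<le> real n2"
      using real_arch_simple by blast
    define n where "n = max n1 n2"
    have "1 / real (Suc n) \<le> 1 / real (Suc n1)"
      by (rule divide_left_mono) (auto simp: n_def)
    with n1 have n1': "1 / real (Suc n) < d"
      by simp
    have n2': "norm x + 1 \<le> real n"
      using n2 unfolding n_def by linarith
    have "norm (blinfun_apply (T t) x) \<le> real n" if "t \<in> {0..1 / real (Suc n)}" for t
    proof (cases "t = 0")
      case True
      then show ?thesis
        using n2' by (simp add: C0_semigroup_zero[OF T])
    next
      case False
      then have "norm (blinfun_apply (T t) x) < norm x + 1"
        using that n1' by (intro d) auto
      then show ?thesis
        using n2' by simp
    qed
    then have "x \<in> E n"
      by (simp add: E_def)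
    then show ?thesis ..
  qed
  then have union: "\<Union> (range E) = UNIV"
    by blast
  have "\<exists>n. interior (E n) \<noteq> {}"
  proof (rule ccontr)
    assume "\<nexists>n. interior (E n) \<noteq> {}"
    then have "euclidean interior_of \<Union> (range E) = {}"
      using closed_E
      by (intro Baire_category_alt) (auto simp: completely_metrizable_space_euclidean)
    then show False
      by (simp add: union)
  qed
  then obtain n z where "z \<in> interior (E n)"
    by blast
  then obtain r where r: "r > 0" "ball z r \<subseteq> E n"
    by (meson mem_interior)
  have bound: "norm (blinfun_apply (T t) x) \<le> (4 * real n / r) * norm x"
    if t: "0 \<le> t" "t \<le> 1 / real (Suc n)" for t x
  proof (cases "x = 0")
    case False
    define c where "c = r / (2 * norm x)"
    have c: "c > 0"
      using False r by (simp add: c_def)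
    have "norm (c *\<^sub>R x) < r"
      using False r by (simp add: c_def)
    then have "z + c *\<^sub>R x \<in> E n" "z \<in> E n"
      using r by (auto simp: subset_iff dist_norm)
    then have "norm (blinfun_apply (T t) (z + c *\<^sub>R x)) \<le> real n" "norm (blinfun_apply (T t) z) \<le> real n"
      using t by (auto simp: E_def)
    moreover have "c * norm (blinfun_apply (T t) x)
        = norm (blinfun_apply (T t) (z + c *\<^sub>R x) - blinfun_apply (T t) z)"
      using c by (simp add: blinfun.add_right blinfun.scaleR_right)
    ultimately have "c * norm (blinfun_apply (T t) x) \<le> 2 * real n"
      using norm_triangle_ineq4[of "blinfun_apply (T t) (z + c *\<^sub>R x)" "blinfun_apply (T t) z"] by linarith
    then show ?thesis
      using False r by (simp add: c_def field_simps)
  qed simp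
  show thesis
    by (rule that[of "1 / real (Suc n)" "4 * real n / r"]) (use r bound in auto)
qed

text \<open>
  Right continuity at \<open>t\<close> needs only the operator \<open>T t\<close>. On the left,
  \<open>T t x - T (t - h) x = T (t - h) (T h x - x)\<close>, and the operators \<open>T (t - h)\<close> have to be bounded
  uniformly in small \<open>h\<close>; this is what the previous lemma gives.
\<close>

lemma C0_semigroup_continuous_on:
  fixes T :: "real \<Rightarrow> ('a::banach \<Rightarrow>\<^sub>L 'a)"
  assumes T: "C0_semigroup T"
  shows "continuous_on {0..} (\<lambda>t. blinfun_apply (T t) x)"
  unfolding continuous_on_iff
proof (intro ballI allI impI)
  fix t0 e :: real
  assume t0: "t0 \<in> {0..}" and e: "e > 0"
  obtain d B where dB: "d > 0" "B \<ge> 0"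
    "\<And>t x. 0 \<le> t \<Longrightarrow> t \<le> d \<Longrightarrow> norm (blinfun_apply (T t) x) \<le> B * norm x"
    using C0_semigroup_bounded_near_0[OF T] by blast
  define d' where "d' = min d t0"
  define K where "K = 1 + norm (T t0) + B * norm (T (t0 - d'))"
  have K: "K > 0" "norm (T t0) \<le> K" "B * norm (T (t0 - d')) \<le> K"
    using dB by (auto simp: K_def add_pos_nonneg)
  have "((\<lambda>t. blinfun_apply (T t) x) \<longlongrightarrow> x) (at_right 0)"
    using T by (simp add: C0_semigroup_def)
  then have "eventually (\<lambda>t. dist (blinfun_apply (T t) x) x < e / K) (at_right 0)"
    by (rule tendstoD) (use e K in auto)
  then obtain b where b: "b > 0" "\<And>h. 0 < h \<Longrightarrow> h < b \<Longrightarrow> norm (blinfun_apply (T h) x - x) < e / K"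
    unfolding eventually_at_right_field dist_norm by auto
  have close: "norm (S (blinfun_apply (T h) x - x)) < e"
    if S: "\<And>y. norm (S y) \<le> K * norm y" and h: "0 < h" "h < b" for S :: "'a \<Rightarrow> 'a" and h
    using S[of "blinfun_apply (T h) x - x"] b(2)[OF h] K(1)
    by (smt (verit) mult.commute pos_less_divide_eq)
  have "dist (blinfun_apply (T t) x) (blinfun_apply (T t0) x) < e"
    if t: "t \<in> {0..}" "dist t t0 < min b (if t0 = 0 then 1 else d')" for t
  proof (cases t t0 rule: linorder_cases)
    case equal
    then show ?thesis
      using e by simp
  next
    case greater
    have "blinfun_apply (T t) x - blinfun_apply (T t0) x = blinfun_apply (T t0) (blinfun_apply (T (t - t0)) x - x)"
      using C0_semigroup_add[OF T, of t0 "t - t0" x] greater t0 by (simp add: blinfun.diff_right)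
    moreover have "norm (blinfun_apply (T t0) y) \<le> K * norm y" for y
      using norm_blinfun[of "T t0" y] K(2) by (smt (verit) mult_right_mono norm_ge_zero)
    ultimately show ?thesis
      using close[of "blinfun_apply (T t0)" "t - t0"] greater t by (simp add: dist_norm)
  next
    case less
    define h where "h = t0 - t"
    have h: "0 < h" "h < b" "h \<le> d'" "d' \<le> d" "d' \<le> t0" "t = t0 - h"
      using less t by (auto simp: h_def dist_real_def d'_def)
    have "blinfun_apply (T t0) x - blinfun_apply (T t) x = blinfun_apply (T t) (blinfun_apply (T h) x - x)"
      using C0_semigroup_add[OF T, of t h x] h t by (simp add: blinfun.diff_right)
    moreover have "norm (blinfun_apply (T t) y) \<le> K * norm y" for y
    proof -
      have "blinfun_apply (T t) y = blinfun_apply (T (d' - h)) (blinfun_apply (T (t0 - d')) y)"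
        using C0_semigroup_add[OF T, of "d' - h" "t0 - d'" y] h by simp
      then have "norm (blinfun_apply (T t) y) \<le> B * norm (blinfun_apply (T (t0 - d')) y)"
        using dB(3)[of "d' - h" "blinfun_apply (T (t0 - d')) y"] h by simp
      also have "\<dots> \<le> B * (norm (T (t0 - d')) * norm y)"
        by (intro mult_left_mono norm_blinfun dB)
      also have "\<dots> \<le> K * norm y"
        using K(3) by (simp add: mult_right_mono flip: mult.assoc)
      finally show ?thesis .
    qed
    ultimately have "norm (blinfun_apply (T t0) x - blinfun_apply (T t) x) < e"
      using close[of "blinfun_apply (T t)" h] h by simp
    then show ?thesis
      by (simp add: dist_norm norm_minus_commute)
  qed
  moreover have "min b (if t0 = 0 then 1 else d') > 0"
    using b dB t0 by (auto simp: d'_def)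
  ultimately show "\<exists>d>0. \<forall>t\<in>{0..}. dist t t0 < d \<longrightarrow>
      dist (blinfun_apply (T t) x) (blinfun_apply (T t0) x) < e"
    by blast
qed

lemma mild_solution_simps:
  assumes "C0_semigroup T"
  shows "mild_solution T 0 x = x"
    and "0 \<le> s \<Longrightarrow> 0 \<le> t \<Longrightarrow> mild_solution T t (mild_solution T s x) = mild_solution T (s + t) x"
    and "mild_solution T t (c *\<^sub>R x) = c *\<^sub>R mild_solution T t x"
    and "mild_solution T t 0 = 0"
  using C0_semigroup_zero[OF assms] C0_semigroup_add[OF assms, of t s x]
  by (auto simp: mild_solution_def blinfun.scaleR_right add.commute)

lemma continuous_on_mild_solution:
  assumes "C0_semigroup T" "S \<subseteq> {0..}"
  shows "continuous_on S (\<lambda>t. mild_solution T t x)"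
  using continuous_on_subset[OF C0_semigroup_continuous_on[OF assms(1)] assms(2)]
  by (simp add: mild_solution_def)

section \<open>From a Lyapunov function to output-to-state stability\<close>

lemma closed_right_open_induct:
  fixes S :: "real set"
  assumes "closed S" "a \<le> b" "a \<in> S"
    and step: "\<And>t. a \<le> t \<Longrightarrow> t < b \<Longrightarrow> t \<in> S \<Longrightarrow> eventually (\<lambda>s. s \<in> S) (at_right t)"
  shows "b \<in> S"
proof (rule ccontr)
  assume b: "b \<notin> S"
  define t where "t = Sup (S \<inter> {a..b})"
  have bdd: "bdd_above (S \<inter> {a..b})"
    by auto
  have "t \<in> S \<inter> {a..b}"
    unfolding t_def using assms by (intro closed_contains_Sup closed_Int) auto
  then have t: "t \<in> S" "a \<le> t" "t < b"
    using b by (auto simp: less_le)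
  then have "eventually (\<lambda>s. s \<in> S) (at_right t)"
    by (intro step)
  moreover have "eventually (\<lambda>s. s \<in> {t<..<b}) (at_right t)"
    using t(3) by (rule eventually_at_right_real)
  ultimately have "eventually (\<lambda>s. s \<in> S \<and> t < s \<and> s < b) (at_right t)"
    by eventually_elim auto
  then obtain s where "s \<in> S" "t < s" "s < b"
    using eventually_happens' trivial_limit_at_right_real by blast
  moreover from this have "s \<le> t"
    using t cSup_upper[OF _ bdd, of s] by (auto simp: t_def[symmetric])
  ultimately show False
    by simp
qed

text \<open>
  The bound holds on a closed set of times containing \<open>0\<close>. A time at which it holds
  can be moved a little to the right: above \<open>B\<close> by the decay, and at or below \<open>B\<close> by continuity.
  The latter needs room above \<open>B\<close>, which is why the bound is shown with \<open>B + e\<close> first.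
\<close>

lemma decay_above_level_bound:
  fixes g :: "real \<Rightarrow> real"
  assumes cont: "continuous_on {0..t} g" and "0 \<le> t"
    and decay: "\<And>s. 0 \<le> s \<Longrightarrow> s < t \<Longrightarrow> B < g s \<Longrightarrow>
      eventually (\<lambda>h. g (s + h) \<le> exp (- c * h) * g s) (at_right 0)"
    and "0 \<le> B" "0 \<le> c"
  shows "g t \<le> max (exp (- c * t) * g 0) B"
proof (rule field_le_epsilon)
  fix e :: real
  assume e: "e > 0"
  define S where "S = {s \<in> {0..t}. g s \<le> max (exp (- c * s) * g 0) (B + e)}"
  have "t \<in> S"
  proof (rule closed_right_open_induct)
    show "closed S"
      unfolding S_def by (intro continuous_on_closed_Collect_le continuous_intros cont closed_atLeastAtMost)
    show "0 \<in> S"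
      using \<open>0 \<le> t\<close> by (auto simp: S_def)
    fix s
    assume s: "0 \<le> s" "s < t" "s \<in> S"
    have right: "eventually (\<lambda>r. s < r \<and> r < t) (at_right s)"
      using eventually_at_right_real[OF s(2)] by (rule eventually_mono) auto
    show "eventually (\<lambda>r. r \<in> S) (at_right s)"
    proof (cases "B < g s")
      case True
      have "eventually (\<lambda>r. g r \<le> exp (- c * (r - s)) * g s) (at_right s)"
        using decay[OF s(1,2) True] eventually_at_right_to_0[of _ s] by (simp add: add.commute)
      with right show ?thesis
      proof eventually_elim
        case (elim r)
        have "exp (- c * (r - s)) * g s \<le> exp (- c * (r - s)) * max (exp (- c * s) * g 0) (B + e)"
          using s by (intro mult_left_mono) (auto simp: S_def)
        also have "\<dots> = max (exp (- c * r) * g 0) (exp (- c * (r - s)) * (B + e))"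
        proof -
          have "exp (- c * (r - s)) * exp (- c * s) = exp (- c * r)"
            by (simp add: algebra_simps flip: exp_add)
          then show ?thesis
            by (simp add: max_mult_distrib_left flip: mult.assoc)
        qed
        finally have "exp (- c * (r - s)) * g s
            \<le> max (exp (- c * r) * g 0) (exp (- c * (r - s)) * (B + e))" .
        moreover have "exp (- c * (r - s)) * (B + e) \<le> 1 * (B + e)"
          using elim e \<open>0 \<le> B\<close> \<open>0 \<le> c\<close> by (intro mult_right_mono) auto
        then have "max (exp (- c * r) * g 0) (exp (- c * (r - s)) * (B + e))
            \<le> max (exp (- c * r) * g 0) (B + e)"
          by (intro max.mono) auto
        ultimately have "g r \<le> max (exp (- c * r) * g 0) (B + e)"
          using elim by linarith
        then show ?case
          using elim s by (simp add: S_def)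
      qed
    next
      case False
      have "(g \<longlongrightarrow> g s) (at_right s)"
      proof -
        have "(g \<longlongrightarrow> g s) (at s within {0..t})"
          using cont s by (auto simp: continuous_on_def)
        then have "(g \<longlongrightarrow> g s) (at s within {s..t})"
          by (rule tendsto_within_subset) (use s in auto)
        then show ?thesis
          using s by (simp add: at_within_Icc_at_right)
      qed
      then have "eventually (\<lambda>r. g r < B + e) (at_right s)"
        by (rule order_tendstoD) (use False e in auto)
      with right show ?thesis
        by eventually_elim (use s in \<open>auto simp: S_def\<close>)
    qed
  qed (fact \<open>0 \<le> t\<close>)
  then show "g t \<le> max (exp (- c * t) * g 0) B + e"
    using e by (auto simp: S_def)
qed

text \<open>
  Half of the rate is given up to turn the limit superior into an inequality that holds for all
  small times.
\<close>

lemma lie_derivative_imp_decay: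
  assumes "lie_derivative T V x \<le> ereal (- a * V x)" "a > 0" "V x > 0"
  shows "eventually (\<lambda>h. V (mild_solution T h x) \<le> exp (- (a / 2) * h) * V x) (at_right 0)"
proof -
  have "lie_derivative T V x < ereal (- (a / 2) * V x)"
    using assms by (intro le_less_trans[OF assms(1)]) (simp add: field_simps)
  then have "eventually (\<lambda>h. ereal ((V (mild_solution T h x) - V x) / h) < ereal (- (a / 2) * V x)) (at_right 0)"
    unfolding lie_derivative_def by (rule Limsup_lessD)
  moreover have "eventually (\<lambda>h::real. h > 0) (at_right 0)"
    by (rule eventually_at_right_less)
  ultimately show ?thesis
  proof eventually_elim
    case (elim h)
    then have "V (mild_solution T h x) \<le> (1 + (- (a / 2) * h)) * V x"
      by (simp add: field_simps)
    also have "\<dots> \<le> exp (- (a / 2) * h) * V x"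
      using assms by (intro mult_right_mono exp_ge_add_one_self) auto
    finally show ?case .
  qed
qed

lemma bdd_above_output:
  assumes "C0_semigroup T"
  shows "bdd_above ((\<lambda>s. norm (output_trajectory T C s x)) ` {0..t})"
proof -
  have "continuous_on {0..t} (\<lambda>s. norm (output_trajectory T C s x))"
    unfolding output_trajectory_def
    by (intro continuous_intros continuous_on_mild_solution assms) auto
  then show ?thesis
    by (intro bounded_imp_bdd_above compact_imp_bounded compact_continuous_image) auto
qed

lemma class_K_cmult:
  assumes "\<gamma> \<in> class_K" "c > 0"
  shows "(\<lambda>r. c * \<gamma> r) \<in> class_K"
  using assms by (auto simp: class_K_def strict_mono_on_def Pi_iff intro!: continuous_intros)

lemma class_K_mono: "\<gamma> \<in> class_K \<Longrightarrow> 0 \<le> r \<Longrightarrow> r \<le> s \<Longrightarrow> \<gamma> r \<le> \<gamma> s"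
  by (auto simp: class_K_def intro: strict_mono_on_leD)

lemma max_powr:
  fixes x y p :: real
  assumes "0 \<le> x" "0 \<le> y" "0 \<le> p"
  shows "max (x powr p) (y powr p) = max x y powr p"
  using assms by (cases x y rule: linorder_le_cases) (simp_all add: max_absorb1 max_absorb2 powr_mono2)

text \<open>
  If \<open>R\<close> bounds the output on \<open>[0, t]\<close>, then \<open>V\<close> can exceed \<open>k2 * \<eta>(R)^p\<close> only at states
  with \<open>\<parallel>x\<parallel> > \<eta>(R) \<ge> \<eta>(\<parallel>Cx\<parallel>)\<close>, where it decays exponentially.
\<close>

lemma Lyapunov_impl_imp_eOSS:
  fixes T :: "real \<Rightarrow> ('a::banach \<Rightarrow>\<^sub>L 'a)" and C :: "'a \<Rightarrow>\<^sub>L 'b::banach"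
  assumes T: "C0_semigroup T" and V: "coercive_eOSS_Lyapunov_impl T C V"
  shows "eOSS T C"
proof -
  obtain k1 k2 p a \<eta> where pos: "k1 > 0" "k2 > 0" "p > 0" "a > 0"
    and coercive: "\<And>x. k1 * norm x powr p \<le> V x" "\<And>x. V x \<le> k2 * norm x powr p"
    and cont: "\<And>x. continuous_on {0..} (\<lambda>t. V (mild_solution T t x))"
    and \<eta>: "\<eta> \<in> class_K_inf"
    and lie: "\<And>x. \<eta> (norm (blinfun_apply C x)) \<le> norm x \<Longrightarrow>
      lie_derivative T V x \<le> ereal (- a * norm x powr p)"
    using V unfolding coercive_eOSS_Lyapunov_impl_def by (auto 0 4)
  have \<eta>K: "\<eta> \<in> class_K"
    using \<eta> by (simp add: class_K_inf_def)
  have \<eta>0: "0 \<le> \<eta> r" if "0 \<le> r" for r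
    using \<eta>K that by (auto simp: class_K_def)
  define c where "c = a / k2"
  define q where "q = (k2 / k1) powr (1 / p)"
  have c: "c > 0" and q: "q > 0"
    using pos by (auto simp: c_def q_def)
  have decay: "eventually (\<lambda>h. V (mild_solution T h x) \<le> exp (- (c / 2) * h) * V x) (at_right 0)"
    if R: "norm (blinfun_apply C x) \<le> R" "k2 * \<eta> R powr p < V x" for R x
  proof (rule lie_derivative_imp_decay)
    have R0: "0 \<le> R"
      using R(1) norm_ge_zero order_trans by blast
    have "k2 * \<eta> R powr p < k2 * norm x powr p"
      using R(2) coercive(2)[of x] by simp
    then have "\<eta> R powr p < norm x powr p"
      using pos by simp
    then have "\<eta> R < norm x"
      using pos powr_mono2[of p "norm x" "\<eta> R"] by (smt (verit) norm_ge_zero)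
    then have "\<eta> (norm (blinfun_apply C x)) \<le> norm x"
      using class_K_mono[OF \<eta>K norm_ge_zero R(1)] by simp
    then have "lie_derivative T V x \<le> ereal (- a * norm x powr p)"
      by (rule lie)
    also have "\<dots> \<le> ereal (- c * V x)"
      using coercive(2)[of x] pos by (simp add: c_def field_simps)
    finally show "lie_derivative T V x \<le> ereal (- c * V x)" .
    show "V x > 0"
      using R(2) pos by (smt (verit) mult_nonneg_nonneg powr_ge_zero)
  qed (fact c)
  have "norm (mild_solution T t x) \<le>
      q * exp (- (c / (2 * p)) * t) * norm x + q * \<eta> (SUP s\<in>{0..t}. norm (output_trajectory T C s x))"
    if t: "t \<ge> 0" for t x
  proof -
    define R where "R = (SUP s\<in>{0..t}. norm (output_trajectory T C s x))"
    have out: "norm (output_trajectory T C s x) \<le> R" if "s \<in> {0..t}" for s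
      unfolding R_def by (rule cSUP_upper[OF that bdd_above_output[OF T]])
    have R0: "R \<ge> 0"
      using out[of 0] t by (smt (verit) atLeastAtMost_iff norm_ge_zero)
    have "V (mild_solution T t x)
        \<le> max (exp (- (c / 2) * t) * V (mild_solution T 0 x)) (k2 * \<eta> R powr p)"
    proof (rule decay_above_level_bound)
      show "continuous_on {0..t} (\<lambda>t. V (mild_solution T t x))"
        by (rule continuous_on_subset[OF cont]) auto
      fix s
      assume s: "0 \<le> s" "s < t" "k2 * \<eta> R powr p < V (mild_solution T s x)"
      have "eventually (\<lambda>h. V (mild_solution T h (mild_solution T s x))
          \<le> exp (- (c / 2) * h) * V (mild_solution T s x)) (at_right 0)"
        by (rule decay[OF _ s(3)]) (use out[of s] s in \<open>simp add: output_trajectory_def\<close>)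
      moreover have "eventually (\<lambda>h::real. h > 0) (at_right 0)"
        by (rule eventually_at_right_less)
      ultimately show "eventually (\<lambda>h. V (mild_solution T (s + h) x)
          \<le> exp (- (c / 2) * h) * V (mild_solution T s x)) (at_right 0)"
        by eventually_elim (use s in \<open>simp add: mild_solution_simps[OF T]\<close>)
    qed (use t pos c in auto)
    also have "\<dots> \<le> max (exp (- (c / 2) * t) * (k2 * norm x powr p)) (k2 * \<eta> R powr p)"
      using coercive(2)[of x] pos by (intro max.mono mult_left_mono) (auto simp: mild_solution_simps[OF T])
    finally have "k1 * norm (mild_solution T t x) powr p
        \<le> max (exp (- (c / 2) * t) * (k2 * norm x powr p)) (k2 * \<eta> R powr p)"
      using coercive(1) order_trans by blast
    also have "\<dots> = k2 * max (exp (- (c / 2) * t) * norm x powr p) (\<eta> R powr p)"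
      using pos by (simp add: max_mult_distrib_left mult_ac)
    finally have "norm (mild_solution T t x) powr p
        \<le> (k2 / k1) * max (exp (- (c / 2) * t) * norm x powr p) (\<eta> R powr p)"
      using pos by (simp add: field_simps)
    also have "exp (- (c / 2) * t) * norm x powr p = (exp (- (c / (2 * p)) * t) * norm x) powr p"
      using pos by (simp add: powr_mult exp_powr_real)
    also have "k2 / k1 = q powr p"
      using pos by (simp add: q_def powr_powr)
    also have "max ((exp (- (c / (2 * p)) * t) * norm x) powr p) (\<eta> R powr p)
        = (max (exp (- (c / (2 * p)) * t) * norm x) (\<eta> R)) powr p"
      using pos \<eta>0[OF R0] by (intro max_powr) auto
    also have "q powr p * \<dots> = (q * max (exp (- (c / (2 * p)) * t) * norm x) (\<eta> R)) powr p"
      using q by (simp add: powr_mult max_def)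
    finally have le: "norm (mild_solution T t x) powr p
        \<le> (q * max (exp (- (c / (2 * p)) * t) * norm x) (\<eta> R)) powr p" .
    have "norm (mild_solution T t x) \<le> q * max (exp (- (c / (2 * p)) * t) * norm x) (\<eta> R)"
    proof (rule ccontr)
      assume "\<not> ?thesis"
      then have "(q * max (exp (- (c / (2 * p)) * t) * norm x) (\<eta> R)) powr p < norm (mild_solution T t x) powr p"
        using q \<eta>0[OF R0] by (intro powr_less_mono2 pos) (auto simp: le_max_iff_disj)
      with le show False
        by simp
    qed
    also have "\<dots> \<le> q * (exp (- (c / (2 * p)) * t) * norm x + \<eta> R)"
      using q \<eta>0[OF R0] by (intro mult_left_mono) auto
    finally show ?thesis
      by (simp add: R_def algebra_simps)
  qed
  moreover have "(\<lambda>r. q * \<eta> r) \<in> class_K"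
    by (rule class_K_cmult[OF \<eta>K q])
  moreover have "c / (2 * p) > 0"
    using c pos by simp
  ultimately show ?thesis
    using q unfolding eOSS_def
    by (intro exI[of _ q] exI[of _ "c / (2 * p)"] bexI[of _ "\<lambda>r. q * \<eta> r"] conjI allI impI)
qed

section \<open>Exponential stability modulo output\<close>

text \<open>
  Both sides of the estimate scale with the state. Normalising the output to be
  at most \<open>1\<close> replaces the gain by the linear function of slope \<open>\<gamma> 1\<close>.
\<close>

lemma eOSS_linear_gain:
  fixes T :: "real \<Rightarrow> ('a::banach \<Rightarrow>\<^sub>L 'a)" and C :: "'a \<Rightarrow>\<^sub>L 'b::banach"
  assumes T: "C0_semigroup T" and "eOSS T C"
  obtains M \<mu> g where "M \<ge> 1" "\<mu> > 0" "g > 0"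
    "\<And>x t R. 0 \<le> t \<Longrightarrow> R > 0 \<Longrightarrow> (\<And>s. s \<in> {0..t} \<Longrightarrow> norm (output_trajectory T C s x) \<le> R) \<Longrightarrow>
      norm (mild_solution T t x) \<le> M * exp (- \<mu> * t) * norm x + g * R"
proof -
  obtain M \<mu> \<gamma> where pos: "M > 0" "\<mu> > 0" and \<gamma>: "\<gamma> \<in> class_K"
    and est: "\<And>x t. 0 \<le> t \<Longrightarrow> norm (mild_solution T t x) \<le>
      M * exp (- \<mu> * t) * norm x + \<gamma> (SUP s\<in>{0..t}. norm (output_trajectory T C s x))"
    using assms(2) unfolding eOSS_def by blast
  have "norm (mild_solution T t x) \<le> max 1 M * exp (- \<mu> * t) * norm x + \<gamma> 1 * R"
    if t: "0 \<le> t" and R: "R > 0"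
      and out: "\<And>s. s \<in> {0..t} \<Longrightarrow> norm (output_trajectory T C s x) \<le> R" for x t R
  proof -
    define z where "z = (1 / R) *\<^sub>R x"
    have scale: "norm (mild_solution T s z) = norm (mild_solution T s x) / R"
      "norm (output_trajectory T C s z) = norm (output_trajectory T C s x) / R" for s
      using R by (simp_all add: z_def output_trajectory_def mild_solution_simps[OF T] blinfun.scaleR_right)
    have "(SUP s\<in>{0..t}. norm (output_trajectory T C s z)) \<le> 1"
      using t R out by (intro cSUP_least) (auto simp: scale)
    moreover have "0 \<le> (SUP s\<in>{0..t}. norm (output_trajectory T C s z))"
      using t by (intro cSUP_upper2[OF bdd_above_output[OF T], of 0]) auto
    ultimately have "\<gamma> (SUP s\<in>{0..t}. norm (output_trajectory T C s z)) \<le> \<gamma> 1"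
      using class_K_mono[OF \<gamma>] by blast
    then have "norm (mild_solution T t z) \<le> M * exp (- \<mu> * t) * norm z + \<gamma> 1"
      using est[OF t, of z] by linarith
    then have "norm (mild_solution T t x) / R \<le> (M * exp (- \<mu> * t) * norm x) / R + \<gamma> 1"
      unfolding scale using R by (simp add: z_def)
    then have "norm (mild_solution T t x) \<le> M * exp (- \<mu> * t) * norm x + \<gamma> 1 * R"
      using R by (simp add: field_simps)
    also have "\<dots> \<le> max 1 M * exp (- \<mu> * t) * norm x + \<gamma> 1 * R"
      by (intro add_right_mono mult_right_mono) auto
    finally show ?thesis .
  qed
  moreover have "\<gamma> 1 > 0"
    using \<gamma> strict_mono_onD[of "{0..}" \<gamma> 0 1] by (auto simp: class_K_def)
  ultimately show thesis
    by (intro that[of "max 1 M" \<mu> "\<gamma> 1"]) (use pos in auto)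
qed

text \<open>
  A small-gain argument. If the state dominates a large multiple of the output, the output term
  of the estimate is absorbed by the state, first to give boundedness and then to give a contraction
  by the factor \<open>1 / 2\<close> over a fixed time, which is iterated.
\<close>

lemma eOSS_imp_UGESMO:
  fixes T :: "real \<Rightarrow> ('a::banach \<Rightarrow>\<^sub>L 'a)" and C :: "'a \<Rightarrow>\<^sub>L 'b::banach"
  assumes T: "C0_semigroup T" and "eOSS T C"
  shows "UGESMO T C"
proof -
  obtain M \<mu> g where M: "M \<ge> 1" and \<mu>: "\<mu> > 0" and g: "g > 0"
    and est: "\<And>x t R. 0 \<le> t \<Longrightarrow> R > 0 \<Longrightarrow>
      (\<And>s. s \<in> {0..t} \<Longrightarrow> norm (output_trajectory T C s x) \<le> R) \<Longrightarrow>
      norm (mild_solution T t x) \<le> M * exp (- \<mu> * t) * norm x + g * R"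
    using eOSS_linear_gain[OF assms] by blast
  define \<rho> where "\<rho> = 8 * g * M"
  \<comment> \<open>After time \<open>t0\<close> the transient factor \<open>M * exp (- \<mu> * t0)\<close> equals \<open>1 / 4\<close>.\<close>
  define t0 where "t0 = ln (4 * M) / \<mu>"
  define \<nu> where "\<nu> = ln 2 / t0"
  have \<rho>: "\<rho> > 0"
    using M g by (simp add: \<rho>_def)
  have t0: "t0 > 0"
    using M \<mu> by (simp add: t0_def)
  have \<nu>: "\<nu> > 0"
    using t0 by (simp add: \<nu>_def)
  have exp_t0: "M * exp (- \<mu> * t0) = 1 / 4"
    using M \<mu> by (simp add: t0_def exp_minus)
  have exp_nu: "exp (- \<nu> * t0) = 1 / 2"
    using t0 by (simp add: \<nu>_def exp_minus)
  let ?good = "\<lambda>\<tau> x. \<forall>t\<in>{0..\<tau>}. \<rho> * norm (output_trajectory T C t x) \<le> norm (mild_solution T t x)"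
  have two_bounds: "norm (mild_solution T t x) \<le> 2 * M * norm x"
      "norm (mild_solution T t x) \<le> M * exp (- \<mu> * t) * norm x + norm x / 4"
    if good: "?good \<tau> x" and t: "t \<in> {0..\<tau>}" for \<tau> t x
  proof -
    have "norm (mild_solution T t x) \<le> 2 * M * norm x \<and>
      norm (mild_solution T t x) \<le> M * exp (- \<mu> * t) * norm x + norm x / 4"
    proof (cases "x = 0")
      case False
      have "continuous_on {0..\<tau>} (\<lambda>s. norm (mild_solution T s x))"
        by (intro continuous_intros continuous_on_mild_solution T) auto
      then obtain m where m: "m \<in> {0..\<tau>}"
        "\<And>s. s \<in> {0..\<tau>} \<Longrightarrow> norm (mild_solution T s x) \<le> norm (mild_solution T m x)"
        using continuous_attains_sup[of "{0..\<tau>}" "\<lambda>s. norm (mild_solution T s x)"] t by auto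
      define N where "N = norm (mild_solution T m x)"
      have "norm x \<le> N"
        using m(2)[of 0] t by (simp add: N_def mild_solution_simps[OF T])
      then have N: "N > 0"
        using False by (smt (verit) zero_less_norm_iff)
      have bound: "norm (mild_solution T s x) \<le> M * exp (- \<mu> * s) * norm x + g * (N / \<rho>)"
        if s: "s \<in> {0..\<tau>}" for s
      proof (rule est)
        fix r
        assume "r \<in> {0..s}"
        then have r: "r \<in> {0..\<tau>}"
          using s by auto
        have "\<rho> * norm (output_trajectory T C r x) \<le> N"
          using good r m(2)[OF r] by (force simp: N_def)
        then show "norm (output_trajectory T C r x) \<le> N / \<rho>"
          using \<rho> by (simp add: field_simps)
      qed (use s N \<rho> in auto)
      have gain: "g * (N / \<rho>) = N / (8 * M)"
        using g by (simp add: \<rho>_def)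
      have "N / (8 * M) \<le> N / 2"
        using M N by (intro divide_left_mono) auto
      moreover have "M * exp (- \<mu> * m) * norm x \<le> M * 1 * norm x"
        using M \<mu> m by (intro mult_right_mono mult_left_mono) auto
      ultimately have N2: "N \<le> 2 * M * norm x"
        using bound[OF m(1)] unfolding gain N_def[symmetric] by linarith
      then have "N / (8 * M) \<le> norm x / 4"
        using M by (simp add: field_simps)
      then show ?thesis
        using bound[OF t] m(2)[OF t] N2 unfolding gain N_def[symmetric] by linarith
    qed (simp add: mild_solution_simps[OF T])
    then show "norm (mild_solution T t x) \<le> 2 * M * norm x"
      "norm (mild_solution T t x) \<le> M * exp (- \<mu> * t) * norm x + norm x / 4"
      by auto
  qed
  have decay: "norm (mild_solution T t x) \<le> 4 * M * exp (- \<nu> * t) * norm x"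
    if "?good \<tau> x" "t \<in> {0..\<tau>}" "t \<le> real n * t0" for n \<tau> t x
    using that
  proof (induction n arbitrary: \<tau> t x)
    case 0
    then have "t = 0"
      by auto
    moreover have "1 * norm x \<le> 4 * M * norm x"
      using M by (intro mult_right_mono) auto
    ultimately show ?case
      by (simp add: mild_solution_simps[OF T])
  next
    case (Suc n)
    show ?case
    proof (cases "t \<le> t0")
      case True
      have "1 / 2 = exp (- \<nu> * t0)"
        using exp_nu by simp
      also have "\<dots> \<le> exp (- \<nu> * t)"
        using True \<nu> by simp
      finally have "(4 * M * norm x) * (1 / 2) \<le> (4 * M * norm x) * exp (- \<nu> * t)"
        using M by (intro mult_left_mono) auto
      then show ?thesis
        using two_bounds(1)[OF Suc.prems(1,2)] by (simp add: mult_ac)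
    next
      case False
      define z where "z = mild_solution T t0 x"
      have z: "mild_solution T s z = mild_solution T (t0 + s) x" if "0 \<le> s" for s
        using that t0 by (simp add: z_def mild_solution_simps[OF T])
      have "?good (\<tau> - t0) z"
        using Suc.prems(1) t0 by (auto simp: z output_trajectory_def)
      moreover have "t - t0 \<in> {0..\<tau> - t0}" "t - t0 \<le> real n * t0"
        using Suc.prems False by (auto simp: algebra_simps)
      ultimately have "norm (mild_solution T (t - t0) z) \<le> 4 * M * exp (- \<nu> * (t - t0)) * norm z"
        by (rule Suc.IH)
      moreover have "norm z \<le> norm x / 2"
        using two_bounds(2)[OF Suc.prems(1), of t0] Suc.prems(2) False t0
        unfolding exp_t0 by (simp add: z_def)
      then have "4 * M * exp (- \<nu> * (t - t0)) * norm z \<le> 4 * M * exp (- \<nu> * (t - t0)) * (norm x / 2)"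
        using M by (intro mult_left_mono) auto
      moreover have zt: "mild_solution T (t - t0) z = mild_solution T t x"
        using z[of "t - t0"] False by simp
      moreover have "exp (- \<nu> * t) = exp (- \<nu> * (t - t0)) * (1 / 2)"
        unfolding exp_nu[symmetric] by (simp add: algebra_simps flip: exp_add)
      then have "4 * M * exp (- \<nu> * (t - t0)) * (norm x / 2) = 4 * M * exp (- \<nu> * t) * norm x"
        by simp
      ultimately show ?thesis
        unfolding zt by linarith
    qed
  qed
  have "norm (mild_solution T t x) \<le> 4 * M * exp (- \<nu> * t) * norm x"
    if "?good \<tau> x" "t \<in> {0..\<tau>}" for \<tau> t x
  proof -
    obtain n where "t / t0 \<le> real n"
      using real_arch_simple by blast
    then show ?thesis
      using decay[OF that, of n] t0 by (simp add: field_simps)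
  qed
  moreover have "4 * M > 0"
    using M by simp
  ultimately show ?thesis
    using \<rho> \<nu> unfolding UGESMO_def by blast
qed

section \<open>The supremum of interrupted trajectories\<close>

text \<open>
  The largest value that \<open>f\<close> attains after time \<open>h\<close>, where a value at time \<open>t\<close> counts only up
  to the smallest value that \<open>u\<close> has taken on \<open>[h, t]\<close>: a drop of \<open>u\<close> hides all later
  values of \<open>f\<close>.
\<close>

definition gated_sup :: "(real \<Rightarrow> real) \<Rightarrow> (real \<Rightarrow> real) \<Rightarrow> real \<Rightarrow> real" where
  "gated_sup f u h = (SUP t\<in>{h..}. min (f t) (INF s\<in>{h..t}. u s))"

text \<open>
  All facts about \<open>gated_sup\<close> are read off from this description of its upper bounds. The
  supremum is finite because \<open>u h\<close> is an upper bound, and the infima are attained by compactness.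
\<close>

lemma gated_sup_le_iff:
  fixes f u :: "real \<Rightarrow> real"
  assumes u: "continuous_on {h..} u"
  shows "gated_sup f u h \<le> z \<longleftrightarrow> (\<forall>t\<ge>h. f t \<le> z \<or> (\<exists>s\<in>{h..t}. u s \<le> z))"
proof -
  have attained: "\<exists>m\<in>{h..t}. (INF s\<in>{h..t}. u s) = u m \<and> (\<forall>s\<in>{h..t}. u m \<le> u s)" if "h \<le> t" for t
  proof -
    have "continuous_on {h..t} u"
      by (rule continuous_on_subset[OF u]) auto
    then obtain m where m: "m \<in> {h..t}" "\<And>s. s \<in> {h..t} \<Longrightarrow> u m \<le> u s"
      using continuous_attains_inf[of "{h..t}" u] \<open>h \<le> t\<close> by auto
    then have "(INF s\<in>{h..t}. u s) = u m"
      by (intro cInf_eq_minimum) auto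
    then show ?thesis
      using m by blast
  qed
  have Inf_le: "(INF s\<in>{h..t}. u s) \<le> z \<longleftrightarrow> (\<exists>s\<in>{h..t}. u s \<le> z)" if "h \<le> t" for t z
    using attained[OF that] by (metis order_trans order_refl)
  have "bdd_above ((\<lambda>t. min (f t) (INF s\<in>{h..t}. u s)) ` {h..})"
    by (rule bdd_aboveI[of _ "u h"]) (auto simp: min_le_iff_disj Inf_le intro!: bexI[of _ h])
  then have "gated_sup f u h \<le> z \<longleftrightarrow> (\<forall>t\<in>{h..}. min (f t) (INF s\<in>{h..t}. u s) \<le> z)"
    unfolding gated_sup_def by (intro cSUP_le_iff) auto
  then show ?thesis
    by (auto simp: min_le_iff_disj Inf_le)
qed

lemma gated_sup_bound:
  assumes "continuous_on {h..} u" "h \<le> t"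
  shows "f t \<le> gated_sup f u h \<or> (\<exists>s\<in>{h..t}. u s \<le> gated_sup f u h)"
  using gated_sup_le_iff[OF assms(1), of f "gated_sup f u h"] assms(2) by blast

lemma gated_sup_le_gate:
  assumes "continuous_on {h..} u"
  shows "gated_sup f u h \<le> u h"
  by (subst gated_sup_le_iff[OF assms]) (intro allI impI disjI2 bexI[of _ h], auto)

text \<open>
  Moving the initial time changes \<open>gated_sup\<close> by no more than the oscillation of \<open>f\<close> and \<open>u\<close>
  over the interval between the two initial times, whatever happens later.
\<close>

lemma gated_sup_oscillation:
  fixes f u :: "real \<Rightarrow> real"
  assumes u: "continuous_on {h..} u" and "h \<le> h'"
    and osc: "\<And>s r. s \<in> {h..h'} \<Longrightarrow> r \<in> {h..h'} \<Longrightarrow> \<bar>f s - f r\<bar> \<le> e"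
      "\<And>s r. s \<in> {h..h'} \<Longrightarrow> r \<in> {h..h'} \<Longrightarrow> \<bar>u s - u r\<bar> \<le> e"
  shows "\<bar>gated_sup f u h - gated_sup f u h'\<bar> \<le> e"
proof -
  have u': "continuous_on {h'..} u"
    by (rule continuous_on_subset[OF u]) (use \<open>h \<le> h'\<close> in auto)
  have e: "e \<ge> 0"
    using osc(1)[of h h] \<open>h \<le> h'\<close> by simp
  have "gated_sup f u h \<le> gated_sup f u h' + e"
    unfolding gated_sup_le_iff[OF u]
  proof (intro allI impI)
    fix t
    assume t: "h \<le> t"
    show "f t \<le> gated_sup f u h' + e \<or> (\<exists>s\<in>{h..t}. u s \<le> gated_sup f u h' + e)"
    proof (cases "h' \<le> t")
      case True
      from gated_sup_bound[OF u' this, of f] show ?thesis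
      proof
        assume "\<exists>s\<in>{h'..t}. u s \<le> gated_sup f u h'"
        then obtain s where "s \<in> {h'..t}" "u s \<le> gated_sup f u h'"
          by blast
        then show ?thesis
          using e \<open>h \<le> h'\<close> by (intro disjI2 bexI[of _ s]) auto
      qed (use e in simp)
    next
      case False
      then have "f t \<le> f h' + e" "u t \<le> u h' + e"
        using osc(1)[of t h'] osc(2)[of t h'] t by auto
      moreover have "f h' \<le> gated_sup f u h' \<or> u h' \<le> gated_sup f u h'"
        using gated_sup_bound[OF u' order_refl, of f] by auto
      ultimately show ?thesis
        using t by force
    qed
  qed
  moreover have "gated_sup f u h' \<le> gated_sup f u h + e"
    unfolding gated_sup_le_iff[OF u']
  proof (intro allI impI)
    fix t
    assume t: "h' \<le> t"
    consider "f t \<le> gated_sup f u h" | s where "s \<in> {h..t}" "u s \<le> gated_sup f u h"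
      using gated_sup_bound[OF u, of t f] t \<open>h \<le> h'\<close> by auto
    then show "f t \<le> gated_sup f u h + e \<or> (\<exists>s\<in>{h'..t}. u s \<le> gated_sup f u h + e)"
    proof cases
      case 1
      then show ?thesis
        using e by simp
    next
      case 2
      show ?thesis
      proof (cases "h' \<le> s")
        case True
        then show ?thesis
          using 2 e by force
      next
        case False
        then have "u h' \<le> u s + e"
          using osc(2)[of h' s] 2 \<open>h \<le> h'\<close> by auto
        then show ?thesis
          using 2 t by force
      qed
    qed
  qed
  ultimately show ?thesis
    by linarith
qed

lemma continuous_on_gated_sup:
  fixes f u :: "real \<Rightarrow> real"
  assumes f: "continuous_on {a..} f" and u: "continuous_on {a..} u"
  shows "continuous_on {a..} (gated_sup f u)"
  unfolding continuous_on_iff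
proof (intro ballI allI impI)
  fix h e :: real
  assume h: "h \<in> {a..}" and e: "e > 0"
  have e4: "e / 4 > 0"
    using e by simp
  obtain d1 where d1: "d1 > 0" "\<And>s. s \<in> {a..} \<Longrightarrow> dist s h < d1 \<Longrightarrow> dist (f s) (f h) < e / 4"
    using f[unfolded continuous_on_iff, rule_format, OF h e4] by blast
  obtain d2 where d2: "d2 > 0" "\<And>s. s \<in> {a..} \<Longrightarrow> dist s h < d2 \<Longrightarrow> dist (u s) (u h) < e / 4"
    using u[unfolded continuous_on_iff, rule_format, OF h e4] by blast
  have osc: "\<bar>f s - f r\<bar> \<le> e / 2" "\<bar>u s - u r\<bar> \<le> e / 2"
    if "s \<in> {a..}" "r \<in> {a..}" "dist s h < min d1 d2" "dist r h < min d1 d2" for s r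
  proof -
    have "dist (f s) (f h) < e / 4" "dist (f r) (f h) < e / 4"
      "dist (u s) (u h) < e / 4" "dist (u r) (u h) < e / 4"
      by (rule d1(2) d2(2); use that in simp)+
    then show "\<bar>f s - f r\<bar> \<le> e / 2" "\<bar>u s - u r\<bar> \<le> e / 2"
      unfolding dist_real_def by linarith+
  qed
  have "dist (gated_sup f u h') (gated_sup f u h) < e"
    if h': "h' \<in> {a..}" "dist h' h < min d1 d2" for h'
  proof (cases "h \<le> h'")
    case True
    have "\<bar>gated_sup f u h - gated_sup f u h'\<bar> \<le> e / 2"
      using h h' True
      by (intro gated_sup_oscillation osc continuous_on_subset[OF u]) (auto simp: dist_real_def)
    then show ?thesis
      using e unfolding dist_real_def by linarith
  next
    case False
    have "\<bar>gated_sup f u h' - gated_sup f u h\<bar> \<le> e / 2"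
      using h h' False
      by (intro gated_sup_oscillation osc continuous_on_subset[OF u]) (auto simp: dist_real_def)
    then show ?thesis
      using e unfolding dist_real_def by linarith
  qed
  then show "\<exists>d>0. \<forall>h'\<in>{a..}. dist h' h < d \<longrightarrow> dist (gated_sup f u h') (gated_sup f u h) < e"
    using d1(1) d2(1) by (intro exI[of _ "min d1 d2"]) auto
qed

lemma gated_sup_shift_scale:
  fixes f u :: "real \<Rightarrow> real"
  assumes u: "continuous_on {0..} u" and "0 \<le> h" "c > 0"
  shows "gated_sup (\<lambda>t. c * f (h + t)) (\<lambda>t. c * u (h + t)) 0 = c * gated_sup f u h"
proof -
  have cont: "continuous_on {h..} u"
    by (rule continuous_on_subset[OF u]) (use assms in auto)
  have cont': "continuous_on {0..} (\<lambda>t. c * u (h + t))"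
    by (intro continuous_intros continuous_on_compose2[OF cont]) auto
  have le: "gated_sup (\<lambda>t. c * f (h + t)) (\<lambda>t. c * u (h + t)) 0 \<le> z \<longleftrightarrow> c * gated_sup f u h \<le> z" for z
  proof -
    have "gated_sup (\<lambda>t. c * f (h + t)) (\<lambda>t. c * u (h + t)) 0 \<le> z \<longleftrightarrow>
      (\<forall>t\<ge>0. f (h + t) \<le> z / c \<or> (\<exists>s\<in>{0..t}. u (h + s) \<le> z / c))"
      unfolding gated_sup_le_iff[OF cont'] using \<open>c > 0\<close> by (simp add: field_simps)
    also have "\<dots> \<longleftrightarrow> (\<forall>t\<ge>h. f t \<le> z / c \<or> (\<exists>s\<in>{h..t}. u s \<le> z / c))"
    proof (intro iffI allI impI)
      fix t :: real
      assume *: "\<forall>t\<ge>0. f (h + t) \<le> z / c \<or> (\<exists>s\<in>{0..t}. u (h + s) \<le> z / c)" and "h \<le> t"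
      then have "f t \<le> z / c \<or> (\<exists>s\<in>{0..t - h}. u (h + s) \<le> z / c)"
        using *[rule_format, of "t - h"] by simp
      then show "f t \<le> z / c \<or> (\<exists>s\<in>{h..t}. u s \<le> z / c)"
      proof
        assume "\<exists>s\<in>{0..t - h}. u (h + s) \<le> z / c"
        then obtain s where "s \<in> {0..t - h}" "u (h + s) \<le> z / c"
          by blast
        then show ?thesis
          by (intro disjI2 bexI[of _ "h + s"]) auto
      qed simp
    next
      fix t :: real
      assume *: "\<forall>t\<ge>h. f t \<le> z / c \<or> (\<exists>s\<in>{h..t}. u s \<le> z / c)" and "0 \<le> t"
      then have "f (h + t) \<le> z / c \<or> (\<exists>s\<in>{h..h + t}. u s \<le> z / c)"
        by simp
      then show "f (h + t) \<le> z / c \<or> (\<exists>s\<in>{0..t}. u (h + s) \<le> z / c)"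
      proof
        assume "\<exists>s\<in>{h..h + t}. u s \<le> z / c"
        then obtain s where "s \<in> {h..h + t}" "u s \<le> z / c"
          by blast
        then show ?thesis
          by (intro disjI2 bexI[of _ "s - h"]) auto
      qed simp
    qed
    also have "\<dots> \<longleftrightarrow> c * gated_sup f u h \<le> z"
      unfolding gated_sup_le_iff[OF cont, symmetric] using \<open>c > 0\<close> by (simp add: field_simps)
    finally show ?thesis .
  qed
  show ?thesis
    using le order_refl antisym by metis
qed

section \<open>A Lyapunov function for systems stable modulo output\<close>

lemma lie_derivative_le_if_exp_decay:
  assumes "eventually (\<lambda>h. V (mild_solution T h x) \<le> exp (- \<mu> * h) * V x) (at_right 0)"
  shows "lie_derivative T V x \<le> ereal (- \<mu> * V x)"
proof -
  have "((\<lambda>h. exp (- \<mu> * h)) has_real_derivative - \<mu>) (at 0)"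
    by (auto intro!: derivative_eq_intros)
  then have "((\<lambda>h. (exp (- \<mu> * h) - 1) / h) \<longlongrightarrow> - \<mu>) (at 0)"
    by (simp add: has_field_derivative_iff)
  then have "((\<lambda>h. (exp (- \<mu> * h) - 1) / h) \<longlongrightarrow> - \<mu>) (at_right 0)"
    by (rule filterlim_mono) (auto simp: at_le)
  then have "((\<lambda>h. (exp (- \<mu> * h) - 1) / h * V x) \<longlongrightarrow> - \<mu> * V x) (at_right 0)"
    by (intro tendsto_mult tendsto_const)
  then have "((\<lambda>h. ereal ((exp (- \<mu> * h) - 1) / h * V x)) \<longlongrightarrow> ereal (- \<mu> * V x)) (at_right 0)"
    by simp
  then have "Limsup (at_right 0) (\<lambda>h. ereal ((exp (- \<mu> * h) - 1) / h * V x)) = ereal (- \<mu> * V x)"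
    by (intro lim_imp_Limsup) auto
  moreover have "eventually (\<lambda>h::real. h > 0) (at_right 0)"
    by (rule eventually_at_right_less)
  with assms have "eventually (\<lambda>h. ereal ((V (mild_solution T h x) - V x) / h)
      \<le> ereal ((exp (- \<mu> * h) - 1) / h * V x)) (at_right 0)"
    by eventually_elim (simp add: field_simps)
  then have "lie_derivative T V x \<le> Limsup (at_right 0) (\<lambda>h. ereal ((exp (- \<mu> * h) - 1) / h * V x))"
    unfolding lie_derivative_def by (rule Limsup_mono)
  ultimately show ?thesis
    by simp
qed

lemma linear_in_class_K_inf:
  assumes "c > 0"
  shows "(\<lambda>r. c * r) \<in> class_K_inf"
proof -
  have "\<not> bounded ((\<lambda>r::real. c * r) ` {0..})"
  proof
    assume "bounded ((\<lambda>r::real. c * r) ` {0..})"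
    then obtain B where B: "\<And>r. r \<ge> 0 \<Longrightarrow> \<bar>c * r\<bar> \<le> B"
      by (auto simp: bounded_iff)
    have "\<bar>c * ((\<bar>B\<bar> + 1) / c)\<bar> \<le> B"
      using assms by (intro B) auto
    then show False
      using assms by simp
  qed
  then show ?thesis
    using assms by (auto simp: class_K_inf_def class_K_def strict_mono_on_def intro!: continuous_intros)
qed

text \<open>
  Three nested regions occur. In \<open>\<parallel>x\<parallel> \<ge> \<rho> \<parallel>Cx\<parallel>\<close> the stability estimate holds. In
  \<open>\<parallel>x\<parallel> \<ge> 2 \<rho> \<parallel>Cx\<parallel>\<close> the gate satisfies \<open>u \<ge> K / 2 * f\<close>, so that it lies above everything that
  the stability estimate lets the trajectory reach later; with \<open>K \<ge> 2\<close> it also gives \<open>\<parallel>x\<parallel> \<le> W x\<close>.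
  The decay is claimed for \<open>\<parallel>x\<parallel> \<ge> 4 \<rho> \<parallel>Cx\<parallel>\<close>, since a nonzero state there stays in the second
  region for a short time.
\<close>

lemma UGESMO_imp_Lyapunov_impl:
  fixes T :: "real \<Rightarrow> ('a::banach \<Rightarrow>\<^sub>L 'a)" and C :: "'a \<Rightarrow>\<^sub>L 'b::banach"
  assumes T: "C0_semigroup T" and "UGESMO T C"
  shows "\<exists>V. coercive_eOSS_Lyapunov_impl T C V"
proof -
  obtain \<rho> M \<mu> where pos: "\<rho> > 0" "M > 0" "\<mu> > 0"
    and stable: "\<forall>x. \<forall>\<tau>\<ge>0.
        (\<forall>t\<in>{0..\<tau>}. norm (mild_solution T t x) \<ge> \<rho> * norm (output_trajectory T C t x)) \<longrightarrow>
        (\<forall>t\<in>{0..\<tau>}. norm (mild_solution T t x) \<le> M * exp (- \<mu> * t) * norm x)"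
    using assms(2) unfolding UGESMO_def by (elim exE conjE) (rule that)
  define K where "K = 2 * max 1 M"
  define f where "f x t = exp (\<mu> * t) * norm (mild_solution T t x)" for x t
  define u where "u x t = K * exp (\<mu> * t) *
    (norm (mild_solution T t x) - \<rho> * norm (output_trajectory T C t x))" for x t
  define W where "W x = gated_sup (f x) (u x) 0" for x
  define V where "V x = max (norm x) (W x)" for x
  have K: "K \<ge> 2" "2 * M \<le> K"
    by (auto simp: K_def)
  have cont_f: "continuous_on {0..} (f x)" and cont_u: "continuous_on {0..} (u x)" for x
    unfolding f_def u_def output_trajectory_def
    by (intro continuous_intros continuous_on_mild_solution T order_refl)+

  have W_orbit: "W (mild_solution T h x) = exp (- \<mu> * h) * gated_sup (f x) (u x) h" if h: "0 \<le> h" for h x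
  proof -
    have eqs: "f (mild_solution T h x) t = exp (- \<mu> * h) * f x (h + t)"
      "u (mild_solution T h x) t = exp (- \<mu> * h) * u x (h + t)" if "0 \<le> t" for t
    proof -
      have "exp (\<mu> * t) = exp (- \<mu> * h) * exp (\<mu> * (h + t))"
        by (simp add: algebra_simps flip: exp_add)
      then show "f (mild_solution T h x) t = exp (- \<mu> * h) * f x (h + t)"
        "u (mild_solution T h x) t = exp (- \<mu> * h) * u x (h + t)"
        by (simp_all only: f_def u_def output_trajectory_def mild_solution_simps(2)[OF T h that] mult.assoc)
          (simp_all only: mult_ac)
    qed
    have "W (mild_solution T h x)
        = gated_sup (\<lambda>t. exp (- \<mu> * h) * f x (h + t)) (\<lambda>t. exp (- \<mu> * h) * u x (h + t)) 0"
      unfolding W_def gated_sup_def by (intro SUP_cong INF_cong arg_cong2[of _ _ _ _ min]) (auto simp: eqs)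
    then show ?thesis
      using h by (simp add: gated_sup_shift_scale[OF cont_u])
  qed
  have W_upper: "W x \<le> K * norm x" for x
  proof -
    have "W x \<le> u x 0"
      unfolding W_def by (rule gated_sup_le_gate[OF cont_u])
    also have "\<dots> = K * (norm x - \<rho> * norm (blinfun_apply C x))"
      by (simp add: u_def output_trajectory_def mild_solution_simps[OF T])
    also have "\<dots> \<le> K * norm x"
      using K pos by (intro mult_left_mono) auto
    finally show ?thesis .
  qed
  have W_lower: "norm x \<le> W x" if "2 * \<rho> * norm (blinfun_apply C x) \<le> norm x" for x
  proof -
    have "norm x \<le> K * (norm x / 2)"
      using mult_right_mono[OF K(1) norm_ge_zero[of x]] by simp
    also have "\<dots> \<le> K * (norm x - \<rho> * norm (blinfun_apply C x))"
      using that K by (intro mult_left_mono) auto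
    finally show ?thesis
      using gated_sup_bound[OF cont_u order_refl, of "f x" x]
      by (auto simp: W_def f_def u_def output_trajectory_def mild_solution_simps[OF T])
  qed
  \<comment> \<open>The supremum started at \<open>0\<close> has the additional gate over \<open>[0, h]\<close>, and the point is that this
     gate hides nothing.\<close>
  have gate_open: "gated_sup (f x) (u x) h \<le> W x"
    if h: "0 \<le> h" and good: "\<And>s. s \<in> {0..h} \<Longrightarrow>
        2 * \<rho> * norm (output_trajectory T C s x) \<le> norm (mild_solution T s x)" for h x
  proof -
    have cont: "continuous_on {h..} (u x)"
      by (rule continuous_on_subset[OF cont_u]) (use h in auto)
    have "norm x \<le> W x"
      using good[of 0] h W_lower by (simp add: output_trajectory_def mild_solution_simps[OF T])
    then have W0: "0 \<le> W x"
      by (rule order_trans[OF norm_ge_zero])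
    show ?thesis
      unfolding gated_sup_le_iff[OF cont]
    proof (intro allI impI)
      fix t
      assume t: "h \<le> t"
      show "f x t \<le> W x \<or> (\<exists>s\<in>{h..t}. u x s \<le> W x)"
      proof (rule ccontr)
        assume "\<not> ?thesis"
        then have ft: "W x < f x t" and us: "\<And>s. s \<in> {h..t} \<Longrightarrow> W x < u x s"
          by (auto simp: not_le)
        obtain s where s: "s \<in> {0..t}" "u x s \<le> W x"
          using gated_sup_bound[OF cont_u, of t "f x" x] ft h t by (auto simp: W_def)
        \<comment> \<open>The gate fell to \<open>W x\<close> at \<open>s\<close>, before \<open>h\<close>. There the trajectory is well inside the
           region, and it stays in the region until \<open>t\<close>; the stability estimate started at
           time \<open>s\<close> then bounds \<open>f x t\<close> by \<open>u x s\<close>.\<close>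
        then have sh: "s < h"
          using us[of s] by force
        define z where "z = mild_solution T s x"
        have z: "mild_solution T r z = mild_solution T (s + r) x" if "0 \<le> r" for r
          using that s by (simp add: z_def mild_solution_simps[OF T])
        have "norm (mild_solution T (t - s) z) \<le> M * exp (- \<mu> * (t - s)) * norm z"
        proof (rule stable[rule_format])
          fix r
          assume r: "r \<in> {0..t - s}"
          have "\<rho> * norm (output_trajectory T C (s + r) x) \<le> norm (mild_solution T (s + r) x)"
          proof (cases "s + r \<le> h")
            case True
            have "0 \<le> \<rho> * norm (output_trajectory T C (s + r) x)"
              using pos by simp
            then show ?thesis
              using good[of "s + r"] True r s by simp
          next
            case False
            then have "0 < u x (s + r)"
              using us[of "s + r"] r W0 by force
            then have "0 < norm (mild_solution T (s + r) x) - \<rho> * norm (output_trajectory T C (s + r) x)"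
              using K unfolding u_def by (elim zero_less_mult_pos) simp
            then show ?thesis
              by simp
          qed
          then show "\<rho> * norm (output_trajectory T C r z) \<le> norm (mild_solution T r z)"
            using r by (simp add: z output_trajectory_def)
        qed (use s in auto)
        then have "exp (\<mu> * t) * norm (mild_solution T t x) \<le> exp (\<mu> * t) * (M * exp (- \<mu> * (t - s)) * norm z)"
          using s by (simp add: z)
        also have "\<dots> = M * exp (\<mu> * s) * norm z"
          by (simp add: algebra_simps flip: exp_add)
        also have "\<dots> \<le> K / 2 * exp (\<mu> * s) * norm z"
          using K by (intro mult_right_mono) auto
        also have "\<dots> = K * exp (\<mu> * s) * (norm z / 2)"
          by simp
        also have "\<dots> \<le> u x s"
          unfolding u_def using good[of s] s sh K by (intro mult_left_mono) (auto simp: z_def)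
        finally show False
          using s ft by (simp add: f_def)
      qed
    qed
  qed
  have cont_V: "continuous_on {0..} (\<lambda>t. V (mild_solution T t x))" for x
  proof -
    have "continuous_on {0..} (\<lambda>t. max (norm (mild_solution T t x)) (exp (- \<mu> * t) * gated_sup (f x) (u x) t))"
      by (intro continuous_intros continuous_on_mild_solution T order_refl
          continuous_on_gated_sup cont_f cont_u)
    then show ?thesis
      by (rule continuous_on_eq) (simp add: V_def W_orbit)
  qed
  have decay: "eventually (\<lambda>h. V (mild_solution T h x) \<le> exp (- \<mu> * h) * V x) (at_right 0)"
    if good: "4 * \<rho> * norm (blinfun_apply C x) \<le> norm x" for x
  proof (cases "x = 0")
    case True
    then have "V x = 0"
      using W_upper[of x] by (simp add: V_def)
    then show ?thesis
      using True by (simp add: mild_solution_simps[OF T])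
  next
    case False
    define w where "w s = norm (mild_solution T s x) - 2 * \<rho> * norm (output_trajectory T C s x)" for s
    have "continuous_on {0..} w"
      unfolding w_def output_trajectory_def
      by (intro continuous_intros continuous_on_mild_solution T order_refl)
    moreover have "2 * \<rho> * norm (blinfun_apply C x) < norm x"
      using good zero_less_norm_iff[of x] False by linarith
    then have "0 < w 0"
      by (simp add: w_def output_trajectory_def mild_solution_simps[OF T])
    ultimately obtain d where d: "d > 0" "\<And>s. s \<in> {0..} \<Longrightarrow> dist s 0 < d \<Longrightarrow> dist (w s) (w 0) < w 0"
      unfolding continuous_on_iff by (meson atLeast_iff order_refl)
    have w: "0 \<le> w s" if "0 \<le> s" "s < d" for s
      using d(2)[of s] that by (auto simp: dist_real_def)
    have "V (mild_solution T h x) \<le> exp (- \<mu> * h) * V x" if h: "0 < h" "h < d" for h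
    proof -
      have "norm (mild_solution T h x) \<le> W (mild_solution T h x)"
        using w[of h] h by (intro W_lower) (simp add: w_def output_trajectory_def)
      then have "V (mild_solution T h x) = exp (- \<mu> * h) * gated_sup (f x) (u x) h"
        using h by (simp add: V_def W_orbit)
      also have "\<dots> \<le> exp (- \<mu> * h) * W x"
        using h w by (intro mult_left_mono gate_open) (auto simp: w_def)
      also have "\<dots> \<le> exp (- \<mu> * h) * V x"
        by (simp add: V_def)
      finally show ?thesis .
    qed
    then show ?thesis
      using d(1) unfolding eventually_at_right_field by auto
  qed
  have lie: "lie_derivative T V x \<le> ereal (- \<mu> * norm x powr 1)"
    if "4 * \<rho> * norm (blinfun_apply C x) \<le> norm x" for x
  proof -
    have "lie_derivative T V x \<le> ereal (- \<mu> * V x)"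
      by (rule lie_derivative_le_if_exp_decay[OF decay[OF that]])
    also have "\<dots> \<le> ereal (- \<mu> * norm x powr 1)"
      using pos by (simp add: V_def)
    finally show ?thesis .
  qed
  have "1 * norm x powr 1 \<le> V x \<and> V x \<le> K * norm x powr 1" for x
    using W_upper[of x] mult_right_mono[of 1 K "norm x"] K by (simp add: V_def)
  moreover have "V x \<ge> 0" for x
    by (simp add: V_def le_max_iff_disj)
  moreover have "(\<lambda>r. 4 * \<rho> * r) \<in> class_K_inf"
    using pos by (intro linear_in_class_K_inf) simp
  ultimately have "coercive_eOSS_Lyapunov_impl T C V"
    unfolding coercive_eOSS_Lyapunov_impl_def using pos K cont_V lie
    by (intro conjI allI exI[of _ "1::real"] exI[of _ K] exI[of _ \<mu>] bexI[of _ "\<lambda>r. 4 * \<rho> * r"]) auto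
  then show ?thesis
    by blast
qed

theorem theorem3p3:
  fixes A :: "'a::banach \<Rightarrow> 'a"
    and D :: "'a set"
    and T :: "real \<Rightarrow> ('a \<Rightarrow>\<^sub>L 'a)"
    and C :: "'a \<Rightarrow>\<^sub>L 'b::banach"
  assumes "generates_C0_semigroup A D T"
  shows "((\<exists>V. coercive_eOSS_Lyapunov_impl T C V) \<longleftrightarrow> eOSS T C) \<and>
         (eOSS T C \<longleftrightarrow> UGESMO T C)"
proof -
  have T: "C0_semigroup T"
    using assms by (simp add: generates_C0_semigroup_def)
  show ?thesis
    using Lyapunov_impl_imp_eOSS[OF T] eOSS_imp_UGESMO[OF T] UGESMO_imp_Lyapunov_impl[OF T] by blast
qed

end
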